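(* Let $q>1$ be an integer, let $p_0,\dots,p_{q-1}>0$ with $p_0+\dots+p_{q-1}=1$, let $\theta$ be a permutation of $\{0,1,\dots,q-1\}$, and let $f\in S_q$ be the associated function on $[0,1]$, $f(\Delta^{P_q}_{i_1i_2\ldots i_k\ldots})=\Delta^{P_q}_{\theta(i_1)\theta(i_2)\ldots\theta(i_k)\ldots}$. Then for the Lebesgue integral the following equality holds: $$\int_0^1 f(x)\,dx=\frac{\sum_{t=0}^{q-1}\beta_{\theta(t)}p_t}{1-\sum_{t=0}^{q-1}p_{\theta(t)}p_t}.$$
   Context: Put $P_q=\{p_0,\dots,p_{q-1}\}$, $\beta_0=0$ and $\beta_t=\sum_{l=0}^{t-1}p_l$ for $t=1,\dots,q-1$. For a digit sequence $(i_k)_{k\ge1}$ in $\{0,\dots,q-1\}$ define $$\Delta^{P_q}_{i_1i_2\ldots i_k\ldots}=\beta_{i_1}+\sum_{k=2}^{\infty}\Big(\beta_{i_k}\prod_{r=1}^{k-1}p_{i_r}\Big)\in[0,1],$$ called the $P_q$-representation of this number. A digit $c$ in parentheses, $(c)$, means that $c$ is repeated forever. Every $x\in[0,1]$ has a $P_q$-representation, unique except for the numbers $\Delta^{P_q}_{i_1\ldots i_{m-1}i_m(0)}=\Delta^{P_q}_{i_1\ldots i_{m-1}[i_m-1](q-1)}$ with $i_m\neq0$. Convention: to make $f$ well defined, representations of the argument with period $(q-1)$ are not used, except for the number $1=\Delta^{P_q}_{(q-1)}$. $S_q$ is the class of the $q!$ functions $f_\theta:[0,1]\to[0,1]$, $f_\theta(\Delta^{P_q}_{i_1i_2\ldots})=\Delta^{P_q}_{\theta(i_1)\theta(i_2)\ldots}$,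 where $\theta$ runs over the permutations of $\{0,\dots,q-1\}$. *)

theory Defs
  imports "HOL-Analysis.Analysis"
begin

definition beta :: "(nat \<Rightarrow> real) \<Rightarrow> nat \<Rightarrow> real" where
  "beta p t = (\<Sum>l<t. p l)"

(* Digit sequences are indexed from 0, so d k is the digit i_(k+1); the term with k = 0
   is beta p (d 0) because the product is then empty. *)
definition Delta :: "(nat \<Rightarrow> real) \<Rightarrow> (nat \<Rightarrow> nat) \<Rightarrow> real" where
  "Delta p d = (\<Sum>k. beta p (d k) * (\<Prod>r<k. p (d r)))"

(* Sequences of period (q - 1) are excluded, except for the constant one, which represents 1. *)
definition admissible :: "nat \<Rightarrow> (nat \<Rightarrow> nat) \<Rightarrow> bool" where
  "admissible q d \<longleftrightarrow>
     (\<forall>k. d k < q) \<and> ((\<exists>m. \<forall>k\<ge>m. d k = q - 1) \<longrightarrow> (\<forall>k. d k = q - 1))"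

(* Meaningful for x in [0,1], where exactly one admissible sequence represents x. *)
definition digits :: "nat \<Rightarrow> (nat \<Rightarrow> real) \<Rightarrow> real \<Rightarrow> nat \<Rightarrow> nat" where
  "digits q p x = (THE d. admissible q d \<and> Delta p d = x)"

(* The image sequence need not be admissible; Delta is evaluated on it all the same. *)
definition S_fun :: "nat \<Rightarrow> (nat \<Rightarrow> real) \<Rightarrow> (nat \<Rightarrow> nat) \<Rightarrow> real \<Rightarrow> real" where
  "S_fun q p \<theta> x = Delta p (\<lambda>k. \<theta> (digits q p x k))"

end

theory Submission
  imports Defs
begin

text \<open>
  The graph of \<open>f = S_fun q p \<theta>\<close> is self-similar. Write \<open>\<beta>\<^sub>t = beta p t\<close>. The cylinders
  \<open>[\<beta>\<^sub>t, \<beta>\<^sub>t + p\<^sub>t)\<close>, \<open>t < q\<close>, partition \<open>[0,1)\<close>; the number \<open>x\<close> has first digit \<open>t\<close> iff it lies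
  in the cylinder of \<open>t\<close>, and deleting that digit yields \<open>u\<^sub>t x = (x - \<beta>\<^sub>t) / p\<^sub>t\<close>. Hence
  \<open>f x = \<beta>\<^bsub>\<theta> t\<^esub> + p\<^bsub>\<theta> t\<^esub> f (u\<^sub>t x)\<close> on the cylinder of \<open>t\<close>. Integrating and substituting
  \<open>y = u\<^sub>t x\<close> gives \<open>I = A + B I\<close> for the integral \<open>I\<close>, where \<open>A = \<Sum>\<^sub>t \<beta>\<^bsub>\<theta> t\<^esub> p\<^sub>t\<close> and
  \<open>B = \<Sum>\<^sub>t p\<^bsub>\<theta> t\<^esub> p\<^sub>t\<close>. Since every \<open>p\<^sub>i\<close> is less than 1, also \<open>B < 1\<close>, and \<open>I = A / (1 - B)\<close>.

  To obtain the measurability of \<open>f\<close> along the way, the functional equation is iterated from the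
  zero function instead of being integrated directly. The iterates \<open>approx \<theta> n\<close> are step functions
  with integral \<open>\<Sum>k<n. A B\<^sup>k\<close> (lemma \<open>integral_approx\<close>), and their values on \<open>[0,1)\<close> are the partial
  sums of the series that defines \<open>f\<close> (lemma \<open>approx_Delta\<close>). They lie in \<open>[0,1]\<close>, so dominated
  convergence yields the geometric series \<open>I = \<Sum>k. A B\<^sup>k\<close>.

  The connection with the digit function requires that each \<open>x\<close> in \<open>[0,1)\<close> has exactly one digit
  sequence that is not eventually equal to \<open>q - 1\<close> (lemmas \<open>Delta_proper_inj\<close> and
  \<open>Delta_proper_surj\<close>).
\<close>

section \<open>Weights and cylinder endpoints\<close>

text \<open>A positive probability vector \<open>p 0, \<dots>, p (q - 1)\<close>; values of \<open>p\<close> beyond \<open>q - 1\<close> are arbitrary.\<close>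

locale P_representation =
  fixes q :: nat and p :: "nat \<Rightarrow> real"
  assumes q_gt_1: "q > 1"
    and p_pos: "\<And>i. i < q \<Longrightarrow> p i > 0"
    and p_sum: "(\<Sum>i<q. p i) = 1"
begin

lemma beta_Suc: "beta p (Suc t) = beta p t + p t"
  by (simp add: beta_def)

lemma beta_q: "beta p q = 1"
  by (simp add: beta_def p_sum)

lemma beta_mono: "i \<le> j \<Longrightarrow> j \<le> q \<Longrightarrow> beta p i \<le> beta p j"
  unfolding beta_def by (rule sum_mono2) (auto intro!: less_imp_le p_pos)

lemma beta_nonneg: "t \<le> q \<Longrightarrow> 0 \<le> beta p t"
  unfolding beta_def by (rule sum_nonneg) (auto intro!: less_imp_le p_pos)

lemma beta_less_1: assumes "t < q" shows "beta p t < 1"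
proof -
  have "beta p (Suc t) \<le> beta p q" using assms by (intro beta_mono) auto
  then show ?thesis using p_pos[OF assms] by (simp add: beta_Suc beta_q)
qed

lemma beta_add_p_le_1: "t < q \<Longrightarrow> beta p t + p t \<le> 1"
  using beta_mono[of "Suc t" q] by (simp add: beta_Suc beta_q)

lemma p_less_1: assumes "i < q" shows "p i < 1"
proof -
  obtain j where j: "j < q" "j \<noteq> i"
    using q_gt_1 by (metis One_nat_def less_trans zero_less_one zero_neq_one)
  have "p i + p j = (\<Sum>k\<in>{i, j}. p k)" using j by simp
  also have "\<dots> \<le> (\<Sum>k<q. p k)"
    using assms j by (intro sum_mono2) (auto intro!: less_imp_le p_pos)
  finally show ?thesis using p_pos[OF j(1)] p_sum by simp
qed

section \<open>The series of a digit sequence\<close>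

text \<open>The sum of the first \<open>n\<close> terms of the series \<open>Delta p d\<close>.\<close>

definition partial_Delta :: "(nat \<Rightarrow> nat) \<Rightarrow> nat \<Rightarrow> real" where
  "partial_Delta d n = (\<Sum>k<n. beta p (d k) * (\<Prod>r<k. p (d r)))"

lemma prod_p_nonneg:
  assumes "\<And>k. d k < q" shows "0 \<le> (\<Prod>r<n. p (d r))"
  using assms by (intro prod_nonneg) (auto intro: less_imp_le p_pos)

text \<open>
  The sequences that share their first \<open>n\<close> digits with \<open>d\<close> represent numbers in an interval that
  starts at \<open>partial_Delta d n\<close> and has the product of their weights as its length. Its right endpoint
  is at most 1.
\<close>

lemma partial_Delta_add_prod_le_1:
  assumes "\<And>k. d k < q"
  shows "partial_Delta d n + (\<Prod>r<n. p (d r)) \<le> 1"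
proof (induction n)
  case 0
  then show ?case by (simp add: partial_Delta_def)
next
  case (Suc n)
  have "(\<Prod>r<n. p (d r)) * (beta p (d n) + p (d n)) \<le> (\<Prod>r<n. p (d r)) * 1"
    by (intro mult_left_mono beta_add_p_le_1 prod_p_nonneg assms)
  with Suc show ?case by (simp add: partial_Delta_def algebra_simps)
qed

lemma partial_Delta_le_1:
  assumes "\<And>k. d k < q" shows "partial_Delta d n \<le> 1"
  using partial_Delta_add_prod_le_1[of d n] prod_p_nonneg[of d n] assms by simp

lemma partial_Delta_nonneg:
  assumes "\<And>k. d k < q" shows "0 \<le> partial_Delta d n"
  unfolding partial_Delta_def
  by (intro sum_nonneg mult_nonneg_nonneg prod_p_nonneg beta_nonneg less_imp_le assms)

lemma summable_Delta:
  assumes "\<And>k. d k < q"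
  shows "summable (\<lambda>k. beta p (d k) * (\<Prod>r<k. p (d r)))"
proof (rule summableI_nonneg_bounded)
  show "0 \<le> beta p (d k) * (\<Prod>r<k. p (d r))" for k
    by (intro mult_nonneg_nonneg prod_p_nonneg beta_nonneg less_imp_le assms)
  show "(\<Sum>k<n. beta p (d k) * (\<Prod>r<k. p (d r))) \<le> 1" for n
    using partial_Delta_le_1[of d n] assms by (simp add: partial_Delta_def)
qed

lemma partial_Delta_tendsto:
  assumes "\<And>k. d k < q"
  shows "partial_Delta d \<longlonglongrightarrow> Delta p d"
  using summable_LIMSEQ[OF summable_Delta[of d]] assms
  by (simp add: Delta_def partial_Delta_def[abs_def])

lemma Delta_nonneg:
  assumes "\<And>k. d k < q" shows "0 \<le> Delta p d"
  by (rule LIMSEQ_le_const[OF partial_Delta_tendsto])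
    (auto intro!: assms partial_Delta_nonneg)

lemma Delta_le_1:
  assumes "\<And>k. d k < q" shows "Delta p d \<le> 1"
  by (rule LIMSEQ_le_const2[OF partial_Delta_tendsto])
    (auto intro!: assms partial_Delta_le_1)

lemma partial_Delta_Suc_shift:
  "partial_Delta d (Suc n) = beta p (d 0) + p (d 0) * partial_Delta (\<lambda>k. d (Suc k)) n"
  unfolding partial_Delta_def
  by (simp only: sum.lessThan_Suc_shift prod.lessThan_Suc_shift)
    (simp add: sum_distrib_left mult_ac)

lemma Delta_shift:
  assumes "\<And>k. d k < q"
  shows "Delta p d = beta p (d 0) + p (d 0) * Delta p (\<lambda>k. d (Suc k))"
proof (rule LIMSEQ_unique)
  show "(\<lambda>n. partial_Delta d (Suc n)) \<longlonglongrightarrow> Delta p d"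
    by (intro LIMSEQ_Suc partial_Delta_tendsto assms)
  show "(\<lambda>n. partial_Delta d (Suc n)) \<longlonglongrightarrow>
      beta p (d 0) + p (d 0) * Delta p (\<lambda>k. d (Suc k))"
    unfolding partial_Delta_Suc_shift by (intro tendsto_intros partial_Delta_tendsto assms)
qed

lemma Delta_const_last: "Delta p (\<lambda>k. q - 1) = 1"
proof -
  let ?D = "Delta p (\<lambda>k. q - 1)"
  have lt: "q - 1 < q" using q_gt_1 by simp
  have "?D = beta p (q - 1) + p (q - 1) * ?D"
    using Delta_shift[of "\<lambda>k. q - 1"] lt by simp
  moreover have "beta p (q - 1) + p (q - 1) = 1"
    using beta_Suc[of "q - 1"] beta_q q_gt_1 by simp
  ultimately have "(1 - p (q - 1)) * (?D - 1) = 0" by algebra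
  then show ?thesis using p_less_1[OF lt] by simp
qed

lemma prod_p_tendsto_0:
  assumes "\<And>k. d k < q"
  shows "(\<lambda>n. \<Prod>r<n. p (d r)) \<longlonglongrightarrow> 0"
proof -
  define c where "c = Max (p ` {..<q})"
  have fin: "finite (p ` {..<q})" "p ` {..<q} \<noteq> {}" using q_gt_1 by auto
  have le: "p i \<le> c" if "i < q" for i
    unfolding c_def using that fin by auto
  have "c \<in> p ` {..<q}" unfolding c_def by (rule Max_in[OF fin])
  then have c: "0 < c" "c < 1" using p_pos p_less_1 by auto
  have upper: "(\<Prod>r<n. p (d r)) \<le> c ^ n" for n
    using prod_mono[of "{..<n}" "\<lambda>r. p (d r)" "\<lambda>_. c"] assms le
    by (auto simp: less_imp_le p_pos)
  have geometric: "(\<lambda>n. c ^ n) \<longlonglongrightarrow> 0"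
    using c by (intro LIMSEQ_realpow_zero) auto
  show ?thesis
  proof (rule real_tendsto_sandwich[OF _ _ tendsto_const geometric])
    show "\<forall>\<^sub>F n in sequentially. 0 \<le> (\<Prod>r<n. p (d r))"
      by (intro always_eventually allI prod_p_nonneg assms)
    show "\<forall>\<^sub>F n in sequentially. (\<Prod>r<n. p (d r)) \<le> c ^ n"
      by (intro always_eventually allI upper)
  qed
qed

section \<open>Existence and uniqueness of digit sequences\<close>

text \<open>
  Digit sequences that are not eventually equal to \<open>q - 1\<close>. They are the admissible sequences other
  than the constant \<open>q - 1\<close>, and unlike the admissible sequences they represent exactly the numbers
  in the half-open interval \<open>[0,1)\<close>.
\<close>

definition proper :: "(nat \<Rightarrow> nat) \<Rightarrow> bool" where
  "proper d \<longleftrightarrow> (\<forall>k. d k < q) \<and> (\<forall>m. \<exists>k\<ge>m. d k \<noteq> q - 1)"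

lemma proper_less: "proper d \<Longrightarrow> d k < q"
  by (simp add: proper_def)

lemma proper_shift: assumes "proper d" shows "proper (\<lambda>k. d (Suc k))"
  unfolding proper_def
proof (intro conjI allI)
  show "d (Suc k) < q" for k using assms by (rule proper_less)
  fix m
  obtain k where "k \<ge> Suc m" "d k \<noteq> q - 1" using assms by (auto simp: proper_def)
  then show "\<exists>k\<ge>m. d (Suc k) \<noteq> q - 1" by (intro exI[of _ "k - 1"]) auto
qed

lemma admissible_iff: "admissible q d \<longleftrightarrow> proper d \<or> d = (\<lambda>_. q - 1)"
  using q_gt_1 unfolding admissible_def proper_def by fastforce

lemma Delta_less_1:
  assumes "\<And>k. d k < q" "d n \<noteq> q - 1"
  shows "Delta p d < 1"
  using assms
proof (induction n arbitrary: d)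
  case 0
  have "Suc (d 0) < q" using 0(1)[of 0] 0(2) by simp
  then have "beta p (d 0) + p (d 0) < 1" using beta_less_1[of "Suc (d 0)"] by (simp add: beta_Suc)
  moreover have "p (d 0) * Delta p (\<lambda>k. d (Suc k)) \<le> p (d 0) * 1"
    using 0 by (intro mult_left_mono Delta_le_1 less_imp_le p_pos) auto
  ultimately show ?case using Delta_shift[of d] 0 by simp
next
  case (Suc n)
  have "Delta p (\<lambda>k. d (Suc k)) < 1" using Suc by auto
  then have "p (d 0) * Delta p (\<lambda>k. d (Suc k)) < p (d 0) * 1"
    using Suc.prems(1) by (intro mult_strict_left_mono p_pos) auto
  then show ?case using Delta_shift[of d] Suc.prems(1) beta_add_p_le_1[of "d 0"] by fastforce
qed

lemma Delta_proper:
  assumes "proper d" shows "Delta p d \<in> {0..<1}"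
proof -
  obtain n where "d n \<noteq> q - 1" using assms by (auto simp: proper_def)
  then show ?thesis using Delta_nonneg[of d] Delta_less_1[of d n] assms
    by (simp add: proper_def)
qed

text \<open>
  Membership in the cylinder of the digit \<open>t\<close> is expressed by its affine coordinate
  \<open>(x - beta p t) / p t\<close>, which is the number that remains when the first digit is deleted.
\<close>

lemma cylinder_iff:
  assumes "t < q"
  shows "(x - beta p t) / p t \<in> {0..<1} \<longleftrightarrow> beta p t \<le> x \<and> x < beta p (Suc t)"
  using p_pos[OF assms] by (auto simp: beta_Suc field_simps)

lemma cylinder_unique:
  assumes "s < q" "t < q" "(x - beta p s) / p s \<in> {0..<1}" "(x - beta p t) / p t \<in> {0..<1}"
  shows "s = t"
proof (rule ccontr)
  assume "s \<noteq> t"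
  then consider "Suc s \<le> t" | "Suc t \<le> s" by linarith
  then show False
    using assms cylinder_iff beta_mono[of "Suc s" t] beta_mono[of "Suc t" s]
    by cases fastforce+
qed

lemma cylinder_exists:
  assumes "x \<in> {0..<1}"
  shows "\<exists>t<q. (x - beta p t) / p t \<in> {0..<1}"
proof -
  define t where "t = (LEAST t. x < beta p (Suc t))"
  have ex: "x < beta p (Suc (q - 1))" using assms q_gt_1 by (simp add: beta_q)
  have lt: "x < beta p (Suc t)" unfolding t_def using ex by (rule LeastI)
  have "t \<le> q - 1" unfolding t_def using ex by (rule Least_le)
  then have tq: "t < q" using q_gt_1 by simp
  have "beta p t \<le> x"
  proof (cases t)
    case 0
    then show ?thesis using assms by (simp add: beta_def)
  next
    case (Suc s)
    then show ?thesis using not_less_Least[of s "\<lambda>t. x < beta p (Suc t)"] by (simp add: t_def)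
  qed
  with lt tq show ?thesis using cylinder_iff by blast
qed

lemma Delta_proper_shift:
  assumes "proper d"
  shows "(Delta p d - beta p (d 0)) / p (d 0) = Delta p (\<lambda>k. d (Suc k))"
  using Delta_shift[of d] p_pos[of "d 0"] proper_less[OF assms] by simp

lemma Delta_proper_inj:
  assumes "proper d" "proper e" "Delta p d = Delta p e"
  shows "d = e"
proof
  have first: "d 0 = e 0" if "proper d" "proper e" "Delta p d = Delta p e" for d e
  proof (rule cylinder_unique)
    show "(Delta p d - beta p (d 0)) / p (d 0) \<in> {0..<1}"
      by (simp only: Delta_proper_shift[OF that(1)] Delta_proper[OF proper_shift[OF that(1)]])
    show "(Delta p d - beta p (e 0)) / p (e 0) \<in> {0..<1}"
      by (simp only: that(3) Delta_proper_shift[OF that(2)] Delta_proper[OF proper_shift[OF that(2)]])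
  qed (use that proper_less in auto)
  fix n
  show "d n = e n"
    using assms
  proof (induction n arbitrary: d e)
    case (0 d e)
    then show ?case by (rule first)
  next
    case (Suc n d e)
    have "Delta p (\<lambda>k. d (Suc k)) = Delta p (\<lambda>k. e (Suc k))"
      using Delta_proper_shift[OF Suc.prems(1)] Delta_proper_shift[OF Suc.prems(2)]
        first[OF Suc.prems] Suc.prems(3) by simp
    then show ?case
      using Suc.IH[of "\<lambda>k. d (Suc k)" "\<lambda>k. e (Suc k)"] Suc.prems proper_shift by blast
  qed
qed

lemma Delta_proper_surj:
  assumes "x \<in> {0..<1}"
  obtains d where "proper d" "Delta p d = x"
proof -
  obtain g where g: "\<And>y. y \<in> {0..<1} \<Longrightarrow> g y < q \<and> (y - beta p (g y)) / p (g y) \<in> {0..<1}"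
    using cylinder_exists by metis
  \<comment> \<open>The digits of \<open>x\<close> are the first digits along the orbit of \<open>x\<close> under the shift map \<open>T\<close>.\<close>
  define T where "T y = (y - beta p (g y)) / p (g y)" for y
  define d where "d k = g ((T ^^ k) x)" for k
  have T: "(T ^^ k) x \<in> {0..<1}" for k
    by (induction k) (use assms g in \<open>auto simp: T_def\<close>)
  have d: "d k < q" for k using g[OF T[of k]] by (simp add: d_def)
  have step: "(T ^^ k) x = beta p (d k) + p (d k) * (T ^^ Suc k) x" for k
    using p_pos[OF d[of k]] by (simp add: T_def d_def)
  have remainder: "(T ^^ m) x = partial_Delta (\<lambda>k. d (k + m)) n
      + (\<Prod>r<n. p (d (r + m))) * (T ^^ (n + m)) x" for n m
  proof (induction n)
    case 0
    then show ?case by (simp add: partial_Delta_def)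
  next
    case (Suc n)
    show ?case
      by (subst Suc, subst step) (simp add: partial_Delta_def algebra_simps)
  qed
  \<comment> \<open>This is needed for all \<open>m\<close>, not only \<open>m = 0\<close>: a tail of digits \<open>q - 1\<close> would force
    \<open>(T ^^ m) x = 1\<close>, so it also gives that \<open>d\<close> is proper.\<close>
  have tail: "Delta p (\<lambda>k. d (k + m)) = (T ^^ m) x" for m
  proof (rule LIMSEQ_unique)
    show "partial_Delta (\<lambda>k. d (k + m)) \<longlonglongrightarrow> Delta p (\<lambda>k. d (k + m))"
      by (intro partial_Delta_tendsto d)
    have P: "(\<lambda>n. \<Prod>r<n. p (d (r + m))) \<longlonglongrightarrow> 0"
      by (intro prod_p_tendsto_0 d)
    have "(\<lambda>n. (\<Prod>r<n. p (d (r + m))) * (T ^^ (n + m)) x) \<longlonglongrightarrow> 0"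
    proof (rule tendsto_sandwich[OF _ _ tendsto_const P])
      show "\<forall>\<^sub>F n in sequentially. 0 \<le> (\<Prod>r<n. p (d (r + m))) * (T ^^ (n + m)) x"
        using T prod_p_nonneg[of "\<lambda>r. d (r + m)"] d by auto
      have "(\<Prod>r<n. p (d (r + m))) * (T ^^ (n + m)) x \<le> (\<Prod>r<n. p (d (r + m)))" for n
        using T[of "n + m"] prod_p_nonneg[of "\<lambda>r. d (r + m)" n] d
        by (intro mult_left_le) auto
      then show "\<forall>\<^sub>F n in sequentially. (\<Prod>r<n. p (d (r + m))) * (T ^^ (n + m)) x
          \<le> (\<Prod>r<n. p (d (r + m)))" by simp
    qed
    then have "(\<lambda>n. (T ^^ m) x - (\<Prod>r<n. p (d (r + m))) * (T ^^ (n + m)) x) \<longlonglongrightarrow> (T ^^ m) x - 0"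
      by (intro tendsto_diff tendsto_const)
    moreover have "partial_Delta (\<lambda>k. d (k + m)) =
        (\<lambda>n. (T ^^ m) x - (\<Prod>r<n. p (d (r + m))) * (T ^^ (n + m)) x)"
      using remainder[of m] by (intro ext) (simp only: eq_diff_eq)
    ultimately show "partial_Delta (\<lambda>k. d (k + m)) \<longlonglongrightarrow> (T ^^ m) x" by simp
  qed
  have "proper d"
    unfolding proper_def
  proof (intro conjI allI d)
    fix m
    show "\<exists>k\<ge>m. d k \<noteq> q - 1"
    proof (rule ccontr)
      assume "\<not> ?thesis"
      then have "(\<lambda>k. d (k + m)) = (\<lambda>k. q - 1)" by auto
      then have "(T ^^ m) x = 1" using tail[of m] Delta_const_last by simp
      then show False using T[of m] by simp
    qed
  qed
  moreover have "Delta p d = x" using tail[of 0] by simp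
  ultimately show ?thesis by (rule that)
qed

lemma digits_Delta:
  assumes "proper d" shows "digits q p (Delta p d) = d"
  unfolding digits_def
proof (rule the_equality)
  show "admissible q d \<and> Delta p d = Delta p d" using assms by (simp add: admissible_iff)
  fix e assume "admissible q e \<and> Delta p e = Delta p d"
  then show "e = d"
    using Delta_proper_inj[of e d] assms Delta_proper[OF assms] Delta_const_last
    by (auto simp: admissible_iff)
qed

section \<open>Iterates of the functional equation\<close>

text \<open>
  The \<open>n\<close>-th iterate, from the zero function, of the operator that sends \<open>g\<close> to the function equal
  to \<open>beta p (\<theta> t) + p (\<theta> t) * g (u t)\<close> on the cylinder of \<open>t\<close>, where \<open>u t\<close> is the affine
  coordinate on this cylinder, and equal to 0 outside \<open>[0,1)\<close>. The second term carries no indicator because every iterate vanishes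
  outside \<open>[0,1)\<close>.
\<close>

primrec approx :: "(nat \<Rightarrow> nat) \<Rightarrow> nat \<Rightarrow> real \<Rightarrow> real" where
  "approx \<theta> 0 x = 0"
| "approx \<theta> (Suc n) x = (\<Sum>t<q. beta p (\<theta> t) * indicator {0..<1} ((x - beta p t) / p t)
      + p (\<theta> t) * approx \<theta> n ((x - beta p t) / p t))"

lemma approx_outside:
  "x \<notin> {0..<1} \<Longrightarrow> approx \<theta> n x = 0"
proof (induction n arbitrary: x)
  case 0
  then show ?case by simp
next
  case (Suc n)
  have "(x - beta p t) / p t \<notin> {0..<1}" if "t < q" for t
    using Suc.prems that beta_nonneg[of t] beta_mono[of "Suc t" q]
    by (subst cylinder_iff) (auto simp: beta_q)
  then show ?case using Suc.IH by (auto intro!: sum.neutral)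
qed

lemma approx_Delta:
  assumes "proper d"
  shows "approx \<theta> n (Delta p d) = partial_Delta (\<lambda>k. \<theta> (d k)) n"
  using assms
proof (induction n arbitrary: d)
  case 0
  then show ?case by (simp add: partial_Delta_def)
next
  case (Suc n)
  let ?u = "\<lambda>t. (Delta p d - beta p t) / p t"
  let ?D = "Delta p (\<lambda>k. d (Suc k))"
  have D: "?u (d 0) = ?D" by (rule Delta_proper_shift[OF Suc.prems])
  have in01: "?D \<in> {0..<1}" by (intro Delta_proper proper_shift Suc.prems)
  have d0: "d 0 < q" using Suc.prems by (rule proper_less)
  have other: "?u t \<notin> {0..<1}" if "t < q" "t \<noteq> d 0" for t
    using cylinder_unique[of t "d 0" "Delta p d"] that d0 D in01 by auto
  have "approx \<theta> (Suc n) (Delta p d) =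
      (\<Sum>t<q. if t = d 0 then beta p (\<theta> t) + p (\<theta> t) * approx \<theta> n ?D else 0)"
    unfolding approx.simps
  proof (rule sum.cong)
    fix t assume "t \<in> {..<q}"
    then show "beta p (\<theta> t) * indicator {0..<1} (?u t) + p (\<theta> t) * approx \<theta> n (?u t) =
        (if t = d 0 then beta p (\<theta> t) + p (\<theta> t) * approx \<theta> n ?D else 0)"
      using other[of t] approx_outside[of "?u t" \<theta> n] D in01 by (cases "t = d 0") auto
  qed simp
  also have "\<dots> = partial_Delta (\<lambda>k. \<theta> (d k)) (Suc n)"
    using d0 Suc.IH[OF proper_shift[OF Suc.prems]]
    by (simp add: sum.delta partial_Delta_Suc_shift)
  finally show ?case .
qed

text \<open>
  The substitution \<open>y = (x - beta p t) / p t\<close> turns the recursion for the iterates into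
  \<open>I\<^bsub>n+1\<^esub> = A + B I\<^sub>n\<close> for their integrals.
\<close>

lemma integral_approx:
  fixes \<theta> :: "nat \<Rightarrow> nat"
  defines "A \<equiv> \<Sum>t<q. beta p (\<theta> t) * p t" and "B \<equiv> \<Sum>t<q. p (\<theta> t) * p t"
  shows "has_bochner_integral lborel (approx \<theta> n) (\<Sum>k<n. A * B ^ k)"
proof (induction n)
  case 0
  then show ?case by (simp add: has_bochner_integral_zero)
next
  case (Suc n)
  have affine: "has_bochner_integral lborel (\<lambda>x. f ((x - beta p t) / p t)) (p t * I)"
    if "t < q" "has_bochner_integral lborel f I" for t f and I :: real
  proof -
    have "has_bochner_integral lborel (\<lambda>x. f (- beta p t / p t + (1 / p t) * x)) (I /\<^sub>R \<bar>1 / p t\<bar>)"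
      using that(2) p_pos[OF that(1)]
      by (subst lborel_has_bochner_integral_real_affine_iff[symmetric]) auto
    moreover have "- beta p t / p t + (1 / p t) * x = (x - beta p t) / p t" for x
      by (simp add: diff_divide_distrib)
    ultimately show ?thesis using p_pos[OF that(1)] by simp
  qed
  have "has_bochner_integral lborel (indicator {0..<1::real} :: real \<Rightarrow> real) 1"
    using has_bochner_integral_real_indicator[of "{0..<1::real}" lborel] by simp
  then have "has_bochner_integral lborel (approx \<theta> (Suc n))
      (\<Sum>t<q. beta p (\<theta> t) * (p t * 1) + p (\<theta> t) * (p t * (\<Sum>k<n. A * B ^ k)))"
    unfolding approx.simps[abs_def]
    by (intro has_bochner_integral_sum has_bochner_integral_add
        has_bochner_integral_mult_right affine Suc.IH) auto
  also have "(\<Sum>t<q. beta p (\<theta> t) * (p t * 1) + p (\<theta> t) * (p t * (\<Sum>k<n. A * B ^ k)))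
      = A + B * (\<Sum>k<n. A * B ^ k)"
    by (simp add: A_def B_def sum.distrib sum_distrib_right mult.assoc)
  also have "\<dots> = (\<Sum>k<Suc n. A * B ^ k)"
    by (simp only: sum.lessThan_Suc_shift) (simp add: sum_distrib_left mult_ac)
  finally show ?case .
qed

section \<open>The integral\<close>

lemma integral_S_fun:
  assumes \<theta>: "\<And>t. t < q \<Longrightarrow> \<theta> t < q"
  shows "(LINT x:{0..1}|lebesgue. S_fun q p \<theta> x)
           = (\<Sum>t<q. beta p (\<theta> t) * p t) / (1 - (\<Sum>t<q. p (\<theta> t) * p t))"
proof -
  define A where "A = (\<Sum>t<q. beta p (\<theta> t) * p t)"
  define B where "B = (\<Sum>t<q. p (\<theta> t) * p t)"
  \<comment> \<open>Restricting to \<open>[0,1)\<close> drops the number 1, whose digit sequence is not proper.\<close>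
  define G where "G x = indicator {0..<1} x * S_fun q p \<theta> x" for x
  \<comment> \<open>Here \<open>d\<close> is the image digit sequence, which may end in digits \<open>q - 1\<close>.\<close>
  have approx_S: "\<exists>d. (\<forall>k. d k < q) \<and> S_fun q p \<theta> x = Delta p d
      \<and> (\<forall>n. approx \<theta> n x = partial_Delta d n)" if "x \<in> {0..<1}" for x
  proof -
    from that obtain d where d: "proper d" "Delta p d = x" by (rule Delta_proper_surj)
    show ?thesis
      using d digits_Delta[OF d(1)] approx_Delta[OF d(1)] \<theta> proper_less[OF d(1)]
      by (intro exI[of _ "\<lambda>k. \<theta> (d k)"]) (auto simp: S_fun_def)
  qed
  have lim: "(\<lambda>n. approx \<theta> n x) \<longlonglongrightarrow> G x" for x
  proof (cases "x \<in> {0..<1}")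
    case True
    then obtain d where d: "\<And>k. d k < q" "S_fun q p \<theta> x = Delta p d"
        "\<And>n. approx \<theta> n x = partial_Delta d n"
      using approx_S by blast
    then show ?thesis using True partial_Delta_tendsto[of d] by (simp add: G_def)
  qed (simp add: G_def approx_outside)
  have bound: "norm (approx \<theta> n x) \<le> indicator {0..<1} x" for n x
  proof (cases "x \<in> {0..<1}")
    case True
    then obtain d where "\<And>k. d k < q" "\<And>n. approx \<theta> n x = partial_Delta d n"
      using approx_S by blast
    then show ?thesis using True partial_Delta_le_1[of d n] partial_Delta_nonneg[of d n] by simp
  qed (simp add: approx_outside)
  have approx_meas: "approx \<theta> n \<in> borel_measurable lborel" for n
    using integral_approx[of \<theta> n] by (rule borel_measurable_has_bochner_integral)
  have G_meas: "G \<in> borel_measurable lborel"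
    by (rule borel_measurable_LIMSEQ_metric[OF approx_meas lim])
  have "(\<lambda>n. integral\<^sup>L lborel (approx \<theta> n)) \<longlonglongrightarrow> integral\<^sup>L lborel G"
  proof (rule integral_dominated_convergence[where w = "indicator {0..<1}"])
    show "integrable lborel (indicator {0..<1::real} :: real \<Rightarrow> real)" by simp
  qed (use G_meas approx_meas lim bound in auto)
  then have "(\<lambda>n. \<Sum>k<n. A * B ^ k) \<longlonglongrightarrow> integral\<^sup>L lborel G"
    unfolding A_def B_def has_bochner_integral_integral_eq[OF integral_approx] .
  moreover have "(\<lambda>n. \<Sum>k<n. A * B ^ k) \<longlonglongrightarrow> A * (1 / (1 - B))"
  proof -
    have "0 \<le> B" unfolding B_def
      using \<theta> by (intro sum_nonneg mult_nonneg_nonneg less_imp_le p_pos) auto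
    moreover have "B < (\<Sum>t<q. 1 * p t)" unfolding B_def
      using \<theta> q_gt_1 by (intro sum_strict_mono mult_strict_right_mono p_pos p_less_1) auto
    ultimately have "norm B < 1" using p_sum by simp
    then have "(\<lambda>k. A * B ^ k) sums (A * (1 / (1 - B)))"
      by (intro sums_mult geometric_sums)
    then show ?thesis by (simp add: sums_def)
  qed
  ultimately have G_int: "integral\<^sup>L lborel G = A / (1 - B)"
    using LIMSEQ_unique by fastforce
  have "(LINT x:{0..1}|lebesgue. S_fun q p \<theta> x) = integral\<^sup>L lebesgue G"
    unfolding set_lebesgue_integral_def
    by (rule integral_discrete_difference[where X = "{1}"])
      (auto simp: G_def indicator_def)
  also have "\<dots> = integral\<^sup>L lborel G"
    by (rule integral_completion[OF G_meas])
  finally show ?thesis using G_int by (simp add: A_def B_def)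
qed

end

theorem theorem4:
  fixes q :: nat and p :: "nat \<Rightarrow> real" and \<theta> :: "nat \<Rightarrow> nat"
  assumes "q > 1"
    and "\<And>i. i < q \<Longrightarrow> p i > 0"
    and "(\<Sum>i<q. p i) = 1"
    and "\<theta> permutes {..<q}"
  shows "(LINT x:{0..1}|lebesgue. S_fun q p \<theta> x)
           = (\<Sum>t<q. beta p (\<theta> t) * p t) / (1 - (\<Sum>t<q. p (\<theta> t) * p t))"
proof -
  interpret P_representation q p using assms(1-3) by unfold_locales
  have "\<theta> t < q" if "t < q" for t
    using permutes_in_image[OF assms(4), of t] that by simp
  then show ?thesis by (rule integral_S_fun)
qed

end
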